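(* Let $r_n(x,z)\in\mathbb Z[x,z]$, $n\in\mathbb Z$, be defined recursively by $$r_{n+1}(x,z)-t(x,z)\,r_n(x,z)+r_{n-1}(x,z)=0,$$ where $t(x,z)=2+2x-2z-xz+z^2$, with initial conditions $r_0(x,z)=1$ and $r_1(x,z)=z-1$. Then $(x-z)\,r_n(x,z)$ is the defining polynomial of the $\mathrm{PSL}_2\mathbb C$-character variety $X(M_n)$, as a plane curve in the coordinates $(x,z)$. Moreover, for $n\neq 0,1$ (so that $M_n$ is hyperbolic), the defining polynomial of $X_0(M_n)$ is a factor of $r_n(x,z)$.
   Context: For $n\in\mathbb Z$, $M_n$ is the complement in $\mathbb S^3$ of the twist knot $K_{2n}$ (a two-crossing right-handed clasp and a twist region of $|2n|$ crossings, right-handed if $n>0$ and left-handed if $n<0$). Its fundamental group is $$\pi_1(M_n)=\langle a,b\mid a w^n=w^n b\rangle,\qquad w=(ba^{-1}b^{-1}a)^{-1},$$ with $a,b$ meridians. $M_n$ is hyperbolic exactly when $n\ne 0,1$. The character of a representation $\rho:\pi_1(M_n)\to \mathrm{SL}_2\mathbb C$ is the function $g\mapsto\operatorname{trace}(\rho(g))$. The $\mathrm{PSL}_2\mathbb C$-character variety $X(M_n)$ is parameterized by $x=\operatorname{trace}(\rho(a^2))$ and $z=\operatorname{trace}(\rho(ab))$: it is identified with the set of points $(x,z)\in\mathbb C^2$ of this form as $\rho$ ranges over all representations $\pi_1(M_n)\to\mathrm{SL}_2\mathbb C$. "Defining polynomial" means a polynomial in $x,z$ whose zero set in $\mathbb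 C^2$ is the given algebraic set. $X_0(M_n)$ denotes the irreducible component (over $\mathbb C$) of $X(M_n)$ containing the character of the discrete faithful representation of $\pi_1(M_n)$. *)

theory Defs
  imports
    "HOL-Analysis.Analysis"
    "HOL-Algebra.Group"
    "HOL-Computational_Algebra.Computational_Algebra"
begin

section \<open>Group presentations\<close>

text \<open>
  A word over generators of type \<open>'g\<close> is a list of letters; \<open>(g, True)\<close> stands for the
  generator \<open>g\<close> and \<open>(g, False)\<close> for its formal inverse.
\<close>

type_synonym 'g word = "('g \<times> bool) list"

definition word_inv :: "'g word \<Rightarrow> 'g word" where
  "word_inv u = rev (map (\<lambda>(g, e). (g, \<not> e)) u)"

definition word_pow :: "'g word \<Rightarrow> int \<Rightarrow> 'g word" where
  "word_pow u n = concat (replicate (nat \<bar>n\<bar>) (if n \<ge> 0 then u else word_inv u))"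

text \<open>
  The congruence on words for which the quotient is the group presented by the relations
  \<open>u = v\<close>, where \<open>(u, v)\<close> ranges over \<open>R\<close>.
\<close>

inductive word_eq :: "('g word \<times> 'g word) set \<Rightarrow> 'g word \<Rightarrow> 'g word \<Rightarrow> bool"
  for R :: "('g word \<times> 'g word) set" where
  refl: "word_eq R u u"
| sym: "word_eq R u v \<Longrightarrow> word_eq R v u"
| trans: "word_eq R u v \<Longrightarrow> word_eq R v w \<Longrightarrow> word_eq R u w"
| cancel: "word_eq R (p @ [(g, e), (g, \<not> e)] @ q) (p @ q)"
| relation: "(u, v) \<in> R \<Longrightarrow> word_eq R (p @ u @ q) (p @ v @ q)"

definition word_class :: "('g word \<times> 'g word) set \<Rightarrow> 'g word \<Rightarrow> 'g word set" where
  "word_class R u = {v. word_eq R u v}"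

definition presented_group :: "('g word \<times> 'g word) set \<Rightarrow> 'g word set monoid" where
  "presented_group R =
     \<lparr>carrier = range (word_class R),
      monoid.mult = (\<lambda>U V. \<Union>u\<in>U. \<Union>v\<in>V. word_class R (u @ v)),
      one = word_class R []\<rparr>"

lemma word_class_eq_iff: "word_class R u = word_class R v \<longleftrightarrow> word_eq R u v"
  unfolding word_class_def
  by (auto intro: word_eq.refl word_eq.sym word_eq.trans)

lemma word_eq_context: "word_eq R u v \<Longrightarrow> word_eq R (p @ u @ q) (p @ v @ q)"
proof (induction rule: word_eq.induct)
  case (cancel p' g e q')
  show ?case
    using word_eq.cancel[of R "p @ p'" g e "q' @ q"] by simp
next
  case (relation u v p' q')
  then show ?case
    using word_eq.relation[of u v R "p @ p'" "q' @ q"] by simp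
qed (blast intro: word_eq.refl word_eq.sym word_eq.trans)+

lemma word_eq_append:
  assumes "word_eq R u u'" "word_eq R v v'"
  shows "word_eq R (u @ v) (u' @ v')"
proof (rule word_eq.trans)
  show "word_eq R (u @ v) (u' @ v)"
    using word_eq_context[OF assms(1), of "[]" v] by simp
  show "word_eq R (u' @ v) (u' @ v')"
    using word_eq_context[OF assms(2), of u' "[]"] by simp
qed

lemma word_eq_inv_left: "word_eq R (word_inv u @ u) []"
proof (induction u)
  case Nil
  show ?case by (simp add: word_inv_def word_eq.refl)
next
  case (Cons l u)
  obtain g e where l: "l = (g, e)" by (cases l)
  have "word_eq R (word_inv (l # u) @ l # u) (word_inv u @ u)"
    using word_eq.cancel[of R "word_inv u" g "\<not> e" u] by (simp add: l word_inv_def)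
  then show ?case using Cons.IH by (rule word_eq.trans)
qed

lemma mult_presented_group:
  "word_class R u \<otimes>\<^bsub>presented_group R\<^esub> word_class R v = word_class R (u @ v)"
proof -
  have "word_class R (u' @ v') = word_class R (u @ v)"
    if "u' \<in> word_class R u" "v' \<in> word_class R v" for u' v'
  proof -
    have "word_eq R u u'" "word_eq R v v'"
      using that by (simp_all add: word_class_def)
    then have "word_eq R (u @ v) (u' @ v')"
      by (rule word_eq_append)
    then show ?thesis
      unfolding word_class_eq_iff by (rule word_eq.sym)
  qed
  moreover have "u \<in> word_class R u" "v \<in> word_class R v"
    by (simp_all add: word_class_def word_eq.refl)
  ultimately show ?thesis
    unfolding presented_group_def monoid.simps by blast
qed

lemma group_presented_group: "group (presented_group R)"
proof (rule groupI)
  have carrier: "carrier (presented_group R) = range (word_class R)"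
    and one: "\<one>\<^bsub>presented_group R\<^esub> = word_class R []"
    by (simp_all add: presented_group_def)
  fix U assume "U \<in> carrier (presented_group R)"
  then obtain u where u: "U = word_class R u" by (auto simp: carrier)
  show "\<exists>V\<in>carrier (presented_group R). V \<otimes>\<^bsub>presented_group R\<^esub> U = \<one>\<^bsub>presented_group R\<^esub>"
    using word_eq_inv_left[of R u]
    by (auto simp: u carrier one mult_presented_group word_class_eq_iff)
  show "\<one>\<^bsub>presented_group R\<^esub> \<otimes>\<^bsub>presented_group R\<^esub> U = U"
    by (simp add: u one mult_presented_group)
next
  have carrier: "carrier (presented_group R) = range (word_class R)"
    by (simp add: presented_group_def)
  show "\<one>\<^bsub>presented_group R\<^esub> \<in> carrier (presented_group R)"
    by (simp add: presented_group_def)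
  fix U V assume "U \<in> carrier (presented_group R)" "V \<in> carrier (presented_group R)"
  then obtain u v where uv: "U = word_class R u" "V = word_class R v" by (auto simp: carrier)
  show "U \<otimes>\<^bsub>presented_group R\<^esub> V \<in> carrier (presented_group R)"
    by (simp add: uv carrier mult_presented_group)
  fix W assume "W \<in> carrier (presented_group R)"
  then obtain w where w: "W = word_class R w" by (auto simp: carrier)
  show "U \<otimes>\<^bsub>presented_group R\<^esub> V \<otimes>\<^bsub>presented_group R\<^esub> W
      = U \<otimes>\<^bsub>presented_group R\<^esub> (V \<otimes>\<^bsub>presented_group R\<^esub> W)"
    by (simp add: uv w mult_presented_group)
qed


section \<open>Twist knot groups\<close>

datatype gen = Gen_a | Gen_b

text \<open>The word \<open>w = (b a\<^sup>-\<^sup>1 b\<^sup>-\<^sup>1 a)\<^sup>-\<^sup>1\<close>.\<close>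

definition twist_word :: "gen word" where
  "twist_word = word_inv [(Gen_b, True), (Gen_a, False), (Gen_b, False), (Gen_a, True)]"

text \<open>The fundamental group \<open>\<langle>a, b | a w\<^sup>n = w\<^sup>n b\<rangle>\<close> of the complement \<open>M\<^sub>n\<close> of the twist knot.\<close>

definition twist_relations :: "int \<Rightarrow> (gen word \<times> gen word) set" where
  "twist_relations n =
     {([(Gen_a, True)] @ word_pow twist_word n, word_pow twist_word n @ [(Gen_b, True)])}"

definition twist_group :: "int \<Rightarrow> gen word set monoid" where
  "twist_group n = presented_group (twist_relations n)"

definition gen_a :: "int \<Rightarrow> gen word set" where
  "gen_a n = word_class (twist_relations n) [(Gen_a, True)]"

definition gen_b :: "int \<Rightarrow> gen word set" where
  "gen_b n = word_class (twist_relations n) [(Gen_b, True)]"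


section \<open>Representations and characters\<close>

definition SL2C :: "(complex^2^2) monoid" where
  "SL2C = \<lparr>carrier = {A. det A = 1}, monoid.mult = (**), one = mat 1\<rparr>"

text \<open>
  The point \<open>(x, z) = (tr \<rho>(a\<^sup>2), tr \<rho>(ab))\<close> of \<open>\<complex>\<^sup>2\<close> by which the
  character of \<open>\<rho>\<close> is recorded. It does not change when the signs of \<open>\<rho>(a)\<close> and \<open>\<rho>(b)\<close>
  are changed simultaneously.
\<close>

definition character_point :: "int \<Rightarrow> (gen word set \<Rightarrow> complex^2^2) \<Rightarrow> complex \<times> complex" where
  "character_point n \<rho> =
     (trace (\<rho> (gen_a n \<otimes>\<^bsub>twist_group n\<^esub> gen_a n)),
      trace (\<rho> (gen_a n \<otimes>\<^bsub>twist_group n\<^esub> gen_b n)))"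

definition character_variety :: "int \<Rightarrow> (complex \<times> complex) set" where
  "character_variety n = character_point n ` hom (twist_group n) SL2C"

text \<open>
  \<open>\<rho>\<close> is a lift to \<open>SL\<^sub>2\<complex>\<close> of a discrete faithful representation to \<open>PSL\<^sub>2\<complex>\<close>. Since
  \<open>SL\<^sub>2\<complex> \<rightarrow> PSL\<^sub>2\<complex>\<close> has finite kernel, discreteness of the image may be tested in \<open>SL\<^sub>2\<complex>\<close>;
  faithfulness means injectivity up to sign. Every such representation of the fundamental
  group of a hyperbolic knot complement has finite covolume, so no further condition is
  needed to obtain the holonomy representation (up to conjugation, orientation and choice
  of lift).
\<close>

definition discrete_faithful :: "int \<Rightarrow> (gen word set \<Rightarrow> complex^2^2) \<Rightarrow> bool" where
  "discrete_faithful n \<rho> \<longleftrightarrow>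
     \<rho> \<in> hom (twist_group n) SL2C \<and>
     discrete (\<rho> ` carrier (twist_group n)) \<and>
     (\<forall>g\<in>carrier (twist_group n). \<forall>h\<in>carrier (twist_group n).
        \<rho> g = \<rho> h \<or> \<rho> g = - \<rho> h \<longrightarrow> g = h)"


section \<open>Plane algebraic sets\<close>

text \<open>
  A polynomial in \<open>x\<close> and \<open>z\<close> is a polynomial in \<open>z\<close> (outer variable) whose coefficients are
  polynomials in \<open>x\<close> (inner variable).
\<close>

definition varX :: "'a::comm_ring_1 poly poly" where
  "varX = [:[:0, 1:]:]"

definition varZ :: "'a::comm_ring_1 poly poly" where
  "varZ = [:0, 1:]"

definition eval_xz :: "'a::comm_ring_1 poly poly \<Rightarrow> 'a \<times> 'a \<Rightarrow> 'a" where
  "eval_xz p = (\<lambda>(x, z). poly (poly p [:z:]) x)"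

definition complexify :: "int poly poly \<Rightarrow> complex poly poly" where
  "complexify = map_poly (map_poly of_int)"

definition defining_polynomial :: "complex poly poly \<Rightarrow> (complex \<times> complex) set \<Rightarrow> bool" where
  "defining_polynomial p V \<longleftrightarrow> {v. eval_xz p v = 0} = V"

definition algebraic_set :: "(complex \<times> complex) set \<Rightarrow> bool" where
  "algebraic_set V \<longleftrightarrow> (\<exists>P. V = {v. \<forall>p\<in>P. eval_xz p v = 0})"

definition irreducible_set :: "(complex \<times> complex) set \<Rightarrow> bool" where
  "irreducible_set V \<longleftrightarrow> algebraic_set V \<and> V \<noteq> {} \<and>
     (\<forall>A B. algebraic_set A \<and> algebraic_set B \<and> V = A \<union> B \<longrightarrow> V = A \<or> V = B)"

definition irreducible_component ::
    "(complex \<times> complex) set \<Rightarrow> (complex \<times> complex) set \<Rightarrow> bool" where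
  "irreducible_component C V \<longleftrightarrow> irreducible_set C \<and> C \<subseteq> V \<and>
     (\<forall>D. irreducible_set D \<and> C \<subseteq> D \<and> D \<subseteq> V \<longrightarrow> D = C)"

end

theory Submission
  imports Defs "HOL-Computational_Algebra.Field_as_Ring"
begin

text \<open>
  Let \<open>A, B \<in> SL\<^sub>2\<complex>\<close> have equal trace, \<open>x = tr A\<^sup>2\<close>, \<open>z = tr AB\<close> and \<open>W = A\<^sup>-\<^sup>1 B A B\<^sup>-\<^sup>1\<close>.
  Then \<open>tr W = t(x, z)\<close>, so by Cayley--Hamilton \<open>A W\<^sup>n - W\<^sup>n B\<close> satisfies the recurrence of \<open>r\<^sub>n\<close>;
  comparing the values at \<open>n = 0, 1\<close> gives \<open>A W\<^sup>n - W\<^sup>n B = r\<^sub>n(x, z) (A - B)\<close>. Hence the relation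
  holds iff \<open>r\<^sub>n(x, z) = 0\<close> or \<open>A = B\<close>, and the latter contributes exactly the line \<open>x = z\<close>.

  If a representation has its character on that line, it sends \<open>w\<close> and \<open>a w a\<^sup>-\<^sup>1\<close> to commuting
  matrices. A root \<open>c \<noteq> 2\<close> of \<open>r\<^sub>n(2, z)\<close>, which exists for \<open>n \<noteq> 0\<close>, yields a parabolic
  representation in which they do not commute. So the character of a faithful representation is off
  the line, and a component through it lies in the zero set of \<open>r\<^sub>n\<close>. The divisibility then follows
  from the Nullstellensatz for plane curves.
\<close>

section \<open>Representations of presented groups\<close>

primrec word_val :: "('a, 'c) monoid_scheme \<Rightarrow> ('g \<Rightarrow> 'a) \<Rightarrow> 'g word \<Rightarrow> 'a" where
  "word_val G f [] = \<one>\<^bsub>G\<^esub>"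
| "word_val G f (l # u) =
     (if snd l then f (fst l) else inv\<^bsub>G\<^esub> f (fst l)) \<otimes>\<^bsub>G\<^esub> word_val G f u"

context group
begin

context
  fixes f :: "'g \<Rightarrow> 'a"
  assumes f: "\<And>g. f g \<in> carrier G"
begin

lemma word_val_closed [simp]: "word_val G f u \<in> carrier G"
  by (induction u) (auto simp: f)

lemma word_val_append: "word_val G f (u @ v) = word_val G f u \<otimes> word_val G f v"
  by (induction u) (auto simp: f m_assoc)

lemma word_val_inv: "word_val G f (word_inv u) = inv (word_val G f u)"
proof (induction u)
  case (Cons l u)
  then show ?case
    by (cases l) (auto simp: word_inv_def word_val_append f inv_mult_group)
qed (simp add: word_inv_def)

lemma word_val_pow: "word_val G f (word_pow u n) = word_val G f u [^] n"
proof -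
  have nat_pow: "word_val G f (concat (replicate k v)) = word_val G f v [^] k" for k v
  proof (induction k)
    case (Suc k)
    then show ?case
      by (simp only: replicate_Suc concat.simps word_val_append nat_pow_Suc2[OF word_val_closed])
  qed simp
  show ?thesis
  proof (cases "n \<ge> 0")
    case True
    then show ?thesis
      by (simp only: word_pow_def nat_pow int_pow_def2) simp
  next
    case False
    then have "word_val G f (word_pow u n) = inv (word_val G f u) [^] nat (- n)"
      by (simp add: word_pow_def nat_pow word_val_inv)
    also have "\<dots> = word_val G f u [^] n"
      unfolding nat_pow_inv[OF word_val_closed] int_pow_def2 using False by simp
    finally show ?thesis .
  qed
qed

lemma word_val_cong:
  assumes "\<And>u v. (u, v) \<in> R \<Longrightarrow> word_val G f u = word_val G f v" "word_eq R u v"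
  shows "word_val G f u = word_val G f v"
  using assms(2)
proof (induction rule: word_eq.induct)
  case (cancel p g e q)
  then show ?case
    by (cases e) (auto simp: word_val_append f m_assoc[symmetric])
qed (auto simp: word_val_append assms(1))

text \<open>Von Dyck's theorem. Words in one class have the same value, so the value of an
  arbitrarily chosen representative gives a well-defined map on classes.\<close>

lemma presented_group_hom_exists:
  assumes "\<And>u v. (u, v) \<in> R \<Longrightarrow> word_val G f u = word_val G f v"
  obtains \<rho> where "\<rho> \<in> hom (presented_group R) G"
    "\<And>u. \<rho> (word_class R u) = word_val G f u"
proof
  define \<rho> where "\<rho> U = word_val G f (SOME u. U = word_class R u)" for U
  show \<rho>: "\<rho> (word_class R u) = word_val G f u" for u
  proof -
    have "word_class R u = word_class R (SOME v. word_class R u = word_class R v)"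
      by (rule someI) (rule HOL.refl)
    then have "word_eq R u (SOME v. word_class R u = word_class R v)"
      by (simp only: word_class_eq_iff)
    from word_val_cong[OF assms this] show ?thesis
      by (simp add: \<rho>_def)
  qed
  show "\<rho> \<in> hom (presented_group R) G"
  proof (rule homI)
    fix U V assume "U \<in> carrier (presented_group R)" "V \<in> carrier (presented_group R)"
    then obtain u v where "U = word_class R u" "V = word_class R v"
      by (auto simp: presented_group_def)
    then show "\<rho> (U \<otimes>\<^bsub>presented_group R\<^esub> V) = \<rho> U \<otimes> \<rho> V"
      by (simp add: mult_presented_group \<rho> word_val_append)
  qed (auto simp: presented_group_def \<rho>)
qed

end

text \<open>The uniqueness half of the universal property: the class of a formal inverse letter is
  the inverse in the group, so induction on letters recovers everything from the generators.\<close>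

lemma presented_group_hom_word_class:
  assumes "\<rho> \<in> hom (presented_group R) G"
  shows "\<rho> (word_class R u) = word_val G (\<lambda>g. \<rho> (word_class R [(g, True)])) u"
proof -
  interpret P: group "presented_group R" by (rule group_presented_group)
  interpret H: group_hom "presented_group R" G \<rho>
    by unfold_locales (rule assms)
  have carrier [simp]: "word_class R v \<in> carrier (presented_group R)" for v
    by (simp add: presented_group_def)
  have one: "word_class R [] = \<one>\<^bsub>presented_group R\<^esub>"
    by (simp add: presented_group_def)
  have inv: "word_class R [(g, False)] = inv\<^bsub>presented_group R\<^esub> word_class R [(g, True)]" for g
    using word_eq.cancel[of R "[]" g False "[]"]
    by (intro P.inv_equality[symmetric])
      (auto simp: mult_presented_group word_class_eq_iff one[symmetric])
  show ?thesis
  proof (induction u)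
    case Nil
    then show ?case by (simp add: one)
  next
    case (Cons l u)
    have "word_class R (l # u) = word_class R [l] \<otimes>\<^bsub>presented_group R\<^esub> word_class R u"
      by (simp add: mult_presented_group)
    then show ?case
      using Cons by (cases l) (auto simp: inv)
  qed
qed

end

section \<open>Intertwining matrices\<close>

no_notation fps_nth (infixl \<open>$\<close> 75)

text \<open>The adjugate. On determinant 1 it is the inverse, and its entries are polynomial in
  those of \<open>A\<close>, so identities involving inverses become polynomial identities modulo
  the determinant and trace equations.\<close>

definition adj2 :: "complex^2^2 \<Rightarrow> complex^2^2" where
  "adj2 A = vector [vector [A$2$2, - A$1$2], vector [- A$2$1, A$1$1]]"

lemma mat2_eq_iff:
  fixes A B :: "'a^2^2"
  shows "A = B \<longleftrightarrow> A$1$1 = B$1$1 \<and> A$1$2 = B$1$2 \<and> A$2$1 = B$2$1 \<and> A$2$2 = B$2$2"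
  unfolding vec_eq_iff forall_2 by auto

lemma mat2_mult:
  fixes A B :: "'a::comm_ring_1^2^2"
  shows "(A ** B)$i$j = A$i$1 * B$1$j + A$i$2 * B$2$j"
  by (simp add: matrix_matrix_mult_def sum_2)

lemma mat2_add_rdistrib:
  fixes A B C :: "'a::comm_ring_1^2^2"
  shows "(A + B) ** C = A ** C + B ** C"
  by (simp add: mat2_eq_iff mat2_mult algebra_simps)

lemma trace_2: "trace (A :: 'a::comm_ring_1^2^2) = A$1$1 + A$2$2"
  by (simp add: trace_def sum_2)

lemma adj2_entries [simp]:
  "adj2 A $ 1 $ 1 = A$2$2" "adj2 A $ 1 $ 2 = - A$1$2"
  "adj2 A $ 2 $ 1 = - A$2$1" "adj2 A $ 2 $ 2 = A$1$1"
  by (simp_all add: adj2_def)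

lemma mat2_one_entries [simp]:
  "(mat 1 :: 'a::comm_ring_1^2^2) $ 1 $ 1 = 1" "(mat 1 :: 'a^2^2) $ 1 $ 2 = 0"
  "(mat 1 :: 'a^2^2) $ 2 $ 1 = 0" "(mat 1 :: 'a^2^2) $ 2 $ 2 = 1"
  by (simp_all add: mat_def)

lemma SL2C_simps [simp]:
  "A \<in> carrier SL2C \<longleftrightarrow> det A = 1" "A \<otimes>\<^bsub>SL2C\<^esub> B = A ** B" "\<one>\<^bsub>SL2C\<^esub> = mat 1"
  by (simp_all add: SL2C_def)

lemma det_adj2 [simp]: "det (adj2 A) = det A"
  by (simp add: det_2)

lemma adj2_mult_left: "det A = 1 \<Longrightarrow> adj2 A ** A = mat 1"
  by (auto simp: mat2_eq_iff mat2_mult det_2 algebra_simps)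

lemma group_SL2C: "group SL2C"
  by (rule groupI) (auto simp: det_mul matrix_mul_assoc intro!: exI[of _ "adj2 _"] adj2_mult_left)

interpretation SL2C: group SL2C
  by (rule group_SL2C)

lemma inv_SL2C: "det A = 1 \<Longrightarrow> inv\<^bsub>SL2C\<^esub> A = adj2 A"
  by (rule SL2C.inv_equality) (auto simp: adj2_mult_left)

definition twist_matrix :: "complex^2^2 \<Rightarrow> complex^2^2 \<Rightarrow> complex^2^2" where
  "twist_matrix A B = adj2 A ** B ** A ** adj2 B"

lemma det_twist_matrix: "det A = 1 \<Longrightarrow> det B = 1 \<Longrightarrow> det (twist_matrix A B) = 1"
  by (simp add: twist_matrix_def det_mul)

context
  fixes A B :: "complex^2^2"
  assumes det: "det A = 1" "det B = 1" and trace: "trace A = trace B"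
begin

text \<open>Fricke's formula for the trace of a commutator, here that of \<open>adj2 A\<close> and
  \<open>B\<close>: if \<open>y\<close> is the common trace, then \<open>x = y^2 - 2\<close> and
  \<open>adj2 A ** B\<close> has trace \<open>y^2 - z\<close>.\<close>

lemma trace_twist_matrix:
  fixes x z :: complex
  defines "x \<equiv> trace (A ** A)" and "z \<equiv> trace (A ** B)"
  shows "trace (twist_matrix A B) = 2 + 2 * x - 2 * z - x * z + z\<^sup>2"
proof -
  define a b c d p q r s where ent: "a = A$1$1" "b = A$1$2" "c = A$2$1" "d = A$2$2"
    "p = B$1$1" "q = B$1$2" "r = B$2$1" "s = B$2$2"
  have "a * d - b * c = 1" "p * s - q * r = 1" "a + d = p + s"
    using det trace by (auto simp: ent det_2 trace_2)
  then show ?thesis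
    unfolding x_def z_def twist_matrix_def trace_2 mat2_mult adj2_entries ent[symmetric]
    by algebra
qed

text \<open>
  By Cayley--Hamilton, \<open>B A B\<^sup>-\<^sup>1 = y B A - z B + A\<^sup>-\<^sup>1\<close> and \<open>A\<^sup>-\<^sup>1 B A = y B A - z A + B\<^sup>-\<^sup>1\<close>,
  where \<open>y\<close> is the common trace.
\<close>

lemma twist_matrix_intertwine:
  "(A ** twist_matrix A B - twist_matrix A B ** B) $ i $ j =
     (trace (A ** B) - 1) * (A - B) $ i $ j"
proof -
  define a b c d p q r s where ent: "a = A$1$1" "b = A$1$2" "c = A$2$1" "d = A$2$2"
    "p = B$1$1" "q = B$1$2" "r = B$2$1" "s = B$2$2"
  have eqs: "a * d - b * c = 1" "p * s - q * r = 1" "a + d = p + s"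
    using det trace by (auto simp: ent det_2 trace_2)
  have A: "A ** twist_matrix A B = B ** A ** adj2 B"
    using det(1) by (simp add: twist_matrix_def matrix_mul_assoc)
      (metis SL2C.r_inv SL2C_simps inv_SL2C matrix_mul_lid)
  have B: "twist_matrix A B ** B = adj2 A ** B ** A"
    using det(2) unfolding twist_matrix_def
    by (metis adj2_mult_left matrix_mul_assoc matrix_mul_rid)
  have "\<forall>i j. (A ** twist_matrix A B - twist_matrix A B ** B) $ i $ j =
     (trace (A ** B) - 1) * (A - B) $ i $ j"
    unfolding A B forall_2 vector_minus_component mat2_mult trace_2 adj2_entries ent[symmetric]
    using eqs by (intro conjI; algebra)
  then show ?thesis by blast
qed

end

text \<open>Both outer coefficients are 1, so the recurrence can be solved upwards and downwards
  over any commutative ring. The induction carries two consecutive values to have the data for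
  either direction.\<close>

lemma recurrence_unique:
  fixes X Y :: "int \<Rightarrow> 'a::comm_ring_1"
  assumes X: "\<And>n. X (n + 1) - t * X n + X (n - 1) = 0"
    and Y: "\<And>n. Y (n + 1) - t * Y n + Y (n - 1) = 0"
    and init: "X 0 = Y 0" "X 1 = Y 1"
  shows "X n = Y n"
proof -
  have up: "X (n + 1) = t * X n - X (n - 1)" "Y (n + 1) = t * Y n - Y (n - 1)"
    and down: "X (n - 1) = t * X n - X (n + 1)" "Y (n - 1) = t * Y n - Y (n + 1)" for n
    using X[of n] Y[of n] by (simp_all add: algebra_simps eq_neg_iff_add_eq_0)
  have "X n = Y n \<and> X (n + 1) = Y (n + 1)"
  proof (induction n rule: int_induct[where k = 0])
    case base
    then show ?case by (simp add: init)
  next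
    case (step1 n)
    then show ?case using up[of "n + 1"] by simp
  next
    case (step2 n)
    then show ?case using down[of n] by simp
  qed
  then show ?thesis by simp
qed

text \<open>Cayley-Hamilton: \<open>W + adj2 W\<close> is \<open>trace W\<close> times the identity.
  Multiply by the power \<open>n\<close> of \<open>W\<close> on the left.\<close>

lemma SL2C_pow_recurrence:
  assumes "det W = 1"
  shows "(W [^]\<^bsub>SL2C\<^esub> (n + 1 :: int)) $ i $ j - trace W * (W [^]\<^bsub>SL2C\<^esub> n) $ i $ j
    + (W [^]\<^bsub>SL2C\<^esub> (n - 1)) $ i $ j = 0"
proof -
  have "W [^]\<^bsub>SL2C\<^esub> (n + 1) = W [^]\<^bsub>SL2C\<^esub> n ** W"
    using SL2C.int_pow_mult[of W n 1] assms by simp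
  moreover have "W [^]\<^bsub>SL2C\<^esub> (n - 1) = W [^]\<^bsub>SL2C\<^esub> n ** adj2 W"
    using SL2C.int_pow_mult[of W n "-1"] assms SL2C.int_pow_neg[of W 1] by (simp add: inv_SL2C)
  moreover have "\<forall>j. (P ** W)$i$j - trace W * P$i$j + (P ** adj2 W)$i$j = 0" for P
    by (simp add: forall_2 mat2_mult trace_2 algebra_simps)
  ultimately show ?thesis by metis
qed

text \<open>The sequence \<open>r\<close> is abstract so that it can be instantiated with the values
  of the polynomials at a single point.\<close>

lemma twist_relation_matrix:
  fixes A B :: "complex^2^2" and r :: "int \<Rightarrow> complex"
  assumes det: "det A = 1" "det B = 1" and trace: "trace A = trace B"
    and x: "x = trace (A ** A)" and z: "z = trace (A ** B)"
    and rec: "\<And>n. r (n + 1) - (2 + 2 * x - 2 * z - x * z + z\<^sup>2) * r n + r (n - 1) = 0"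
    and init: "r 0 = 1" "r 1 = z - 1"
  shows "A ** (twist_matrix A B [^]\<^bsub>SL2C\<^esub> n) = (twist_matrix A B [^]\<^bsub>SL2C\<^esub> n) ** B
    \<longleftrightarrow> r n = 0 \<or> A = B"
proof -
  define W where "W = twist_matrix A B"
  define t where "t = 2 + 2 * x - 2 * z - x * z + z\<^sup>2"
  have detW: "det W = 1"
    unfolding W_def using det by (rule det_twist_matrix)
  have tr: "trace W = t"
    unfolding W_def t_def x z by (rule trace_twist_matrix) fact+
  define X where "X n = A ** (W [^]\<^bsub>SL2C\<^esub> n) - (W [^]\<^bsub>SL2C\<^esub> n) ** B" for n :: int
  have "X n $ i $ j = r n * (A - B) $ i $ j" for n i j
  proof (rule recurrence_unique[where t = t and X = "\<lambda>n. X n $ i $ j"])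
    fix n :: int
    have P: "(W [^]\<^bsub>SL2C\<^esub> (n + 1)) $ i $ j = t * (W [^]\<^bsub>SL2C\<^esub> n) $ i $ j
        - (W [^]\<^bsub>SL2C\<^esub> (n - 1)) $ i $ j" for i j
      using SL2C_pow_recurrence[OF detW, of n i j] by (simp add: tr algebra_simps)
    show "X (n + 1) $ i $ j - t * X n $ i $ j + X (n - 1) $ i $ j = 0"
      unfolding X_def vector_minus_component mat2_mult P by algebra
    show "r (n + 1) * (A - B) $ i $ j - t * (r n * (A - B) $ i $ j) + r (n - 1) * (A - B) $ i $ j = 0"
      using rec[of n, folded t_def] by algebra
  next
    show "X 0 $ i $ j = r 0 * (A - B) $ i $ j"
      by (simp add: X_def init)
    show "X 1 $ i $ j = r 1 * (A - B) $ i $ j"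
      using twist_matrix_intertwine[OF det trace, of i j] detW
      by (simp add: X_def init W_def z)
  qed
  then have "X n = 0 \<longleftrightarrow> r n = 0 \<or> A = B"
    by (auto simp: vec_eq_iff)
  then show ?thesis
    by (simp add: X_def W_def)
qed

text \<open>The matrix \<open>P\<close> conjugates \<open>B\<close> to \<open>A\<close>. With
  \<open>P\<close> the power \<open>n\<close> of the twist matrix, this derives from the relation
  the equality of traces that the computations above presuppose.\<close>

lemma intertwined_trace_eq:
  assumes "det P = 1" "A ** P = P ** B"
  shows "trace A = trace (B :: complex^2^2)"
proof -
  have "P ** adj2 P = mat 1"
    using assms(1) SL2C.r_inv[of P] by (simp add: inv_SL2C)
  then have "A = P ** B ** adj2 P"
    by (metis assms(2) matrix_mul_assoc matrix_mul_rid)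
  then have "trace A = trace (adj2 P ** (P ** B))"
    using trace_mul_sym[of "P ** B" "adj2 P"] by simp
  then show ?thesis
    by (simp add: matrix_mul_assoc adj2_mult_left assms(1))
qed

section \<open>Representations of the twist knot group as pairs of matrices\<close>

definition gen_images :: "complex^2^2 \<Rightarrow> complex^2^2 \<Rightarrow> gen \<Rightarrow> complex^2^2" where
  "gen_images A B g = (case g of Gen_a \<Rightarrow> A | Gen_b \<Rightarrow> B)"

lemma gen_images_simps [simp]: "gen_images A B Gen_a = A" "gen_images A B Gen_b = B"
  by (simp_all add: gen_images_def)

lemma det_gen_images: "det A = 1 \<Longrightarrow> det B = 1 \<Longrightarrow> det (gen_images A B g) = 1"
  by (cases g) auto

lemma word_val_twist_word:
  "det A = 1 \<Longrightarrow> det B = 1 \<Longrightarrow> word_val SL2C (gen_images A B) twist_word = twist_matrix A B"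
  by (simp add: twist_word_def word_inv_def twist_matrix_def inv_SL2C matrix_mul_assoc)

lemma word_val_twist_word_pow:
  "det A = 1 \<Longrightarrow> det B = 1 \<Longrightarrow>
    word_val SL2C (gen_images A B) (word_pow twist_word n) = twist_matrix A B [^]\<^bsub>SL2C\<^esub> n"
  by (simp add: SL2C.word_val_pow det_gen_images word_val_twist_word)

lemma twist_hom_exists:
  assumes "det A = 1" "det B = 1"
    and rel: "A ** (twist_matrix A B [^]\<^bsub>SL2C\<^esub> n) = (twist_matrix A B [^]\<^bsub>SL2C\<^esub> n) ** B"
  obtains \<rho> where "\<rho> \<in> hom (twist_group n) SL2C"
    "\<And>u. \<rho> (word_class (twist_relations n) u) = word_val SL2C (gen_images A B) u"
proof (rule SL2C.presented_group_hom_exists[of "gen_images A B" "twist_relations n"])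
  fix u v assume "(u, v) \<in> twist_relations n"
  then show "word_val SL2C (gen_images A B) u = word_val SL2C (gen_images A B) v"
    using rel assms(1,2)
    by (auto simp: twist_relations_def word_val_twist_word_pow SL2C.word_val_append det_gen_images)
qed (use that assms(1,2) in \<open>auto simp: det_gen_images twist_group_def\<close>)

lemma twist_homE:
  assumes "\<rho> \<in> hom (twist_group n) SL2C"
  obtains A B where "det A = 1" "det B = 1"
    "A ** (twist_matrix A B [^]\<^bsub>SL2C\<^esub> n) = (twist_matrix A B [^]\<^bsub>SL2C\<^esub> n) ** B"
    "\<And>u. \<rho> (word_class (twist_relations n) u) = word_val SL2C (gen_images A B) u"
proof -
  define A B where "A = \<rho> (word_class (twist_relations n) [(Gen_a, True)])"
    and "B = \<rho> (word_class (twist_relations n) [(Gen_b, True)])"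
  have det: "det A = 1" "det B = 1"
    using assms unfolding A_def B_def SL2C_simps(1)[symmetric]
    by (auto simp: hom_def Pi_iff twist_group_def presented_group_def)
  have "(\<lambda>g. \<rho> (word_class (twist_relations n) [(g, True)])) = gen_images A B"
    by (rule ext) (auto simp: gen_images_def A_def B_def split: gen.split)
  then have val: "\<rho> (word_class (twist_relations n) u) = word_val SL2C (gen_images A B) u" for u
    using SL2C.presented_group_hom_word_class[of \<rho> "twist_relations n" u] assms
    by (simp add: twist_group_def)
  let ?u = "[(Gen_a, True)] @ word_pow twist_word n" and ?v = "word_pow twist_word n @ [(Gen_b, True)]"
  have "word_eq (twist_relations n) ?u ?v"
    using word_eq.relation[of ?u ?v "twist_relations n" "[]" "[]"]
    by (simp add: twist_relations_def)
  then have "word_class (twist_relations n) ?u = word_class (twist_relations n) ?v"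
    by (simp only: word_class_eq_iff)
  then have "word_val SL2C (gen_images A B) ?u = word_val SL2C (gen_images A B) ?v"
    by (simp only: val[symmetric])
  then have "A ** (twist_matrix A B [^]\<^bsub>SL2C\<^esub> n) = (twist_matrix A B [^]\<^bsub>SL2C\<^esub> n) ** B"
    using det by (simp add: SL2C.word_val_append det_gen_images word_val_twist_word_pow)
  with det val that show ?thesis by blast
qed

lemma character_point_eq:
  assumes "\<And>u. \<rho> (word_class (twist_relations n) u) = word_val SL2C (gen_images A B) u"
  shows "character_point n \<rho> = (trace (A ** A), trace (A ** B))"
  by (simp add: character_point_def twist_group_def gen_a_def gen_b_def mult_presented_group assms)

lemma SL2C_pair_exists:
  fixes x z :: complex
  obtains A B :: "complex^2^2" where "det A = 1" "det B = 1" "trace A = trace B"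
    "trace (A ** A) = x" "trace (A ** B) = z" "x = z \<longrightarrow> A = B"
proof -
  \<comment> \<open>\<open>m\<close> and \<open>k\<close> are the roots of
    \<open>X^2 - y X + 1\<close> with \<open>y^2 = x + 2\<close>; hence \<open>m k = 1\<close> and
    \<open>m^2 + k^2 = y^2 - 2 = x\<close>.\<close>
  define y e where "y = csqrt (x + 2)" and "e = csqrt (y\<^sup>2 - 4)"
  define m k where "m = (y + e) / 2" and "k = (y - e) / 2"
  have "y\<^sup>2 = x + 2" "e\<^sup>2 = y\<^sup>2 - 4"
    by (simp_all add: y_def e_def)
  then have mk: "m * k = 1" "m * m + k * k = x"
    unfolding m_def k_def by (simp_all add: field_simps power2_eq_square)
  show ?thesis
  proof (cases "x = z")
    case True
    \<comment> \<open>On the line \<open>x = z\<close> an abelian representation is wanted, since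
      \<open>A = B\<close> satisfies the relation for every \<open>n\<close>.\<close>
    define A :: "complex^2^2" where "A = vector [vector [m, 0], vector [0, k]]"
    show ?thesis
      by (rule that[of A A]) (use True mk in \<open>simp_all add: A_def det_2 trace_2 mat2_mult\<close>)
  next
    case False
    \<comment> \<open>The lower left entry of \<open>B\<close> enters the trace of
      \<open>A ** B\<close> additively: it is \<open>m^2 + k^2 + (z - x) = z\<close>.\<close>
    define A B :: "complex^2^2" where "A = vector [vector [m, 1], vector [0, k]]"
      and "B = vector [vector [m, 0], vector [z - x, k]]"
    show ?thesis
      by (rule that[of A B])
        (use False mk in \<open>simp_all add: A_def B_def det_2 trace_2 mat2_mult algebra_simps\<close>)
  qed
qed

lemma character_variety_iff:
  fixes r :: "int \<Rightarrow> complex"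
  assumes rec: "\<And>n. r (n + 1) - (2 + 2 * x - 2 * z - x * z + z\<^sup>2) * r n + r (n - 1) = 0"
    and init: "r 0 = 1" "r 1 = z - 1"
  shows "(x, z) \<in> character_variety n \<longleftrightarrow> (x - z) * r n = 0"
proof
  assume "(x, z) \<in> character_variety n"
  then obtain \<rho> where \<rho>: "\<rho> \<in> hom (twist_group n) SL2C" "(x, z) = character_point n \<rho>"
    by (auto simp: character_variety_def)
  obtain A B where AB: "det A = 1" "det B = 1"
    "A ** (twist_matrix A B [^]\<^bsub>SL2C\<^esub> n) = (twist_matrix A B [^]\<^bsub>SL2C\<^esub> n) ** B"
    "\<And>u. \<rho> (word_class (twist_relations n) u) = word_val SL2C (gen_images A B) u"
    using twist_homE[OF \<rho>(1)] by blast
  have xz: "x = trace (A ** A)" "z = trace (A ** B)"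
    using character_point_eq[OF AB(4)] \<rho>(2) by auto
  have "det (twist_matrix A B [^]\<^bsub>SL2C\<^esub> n) = 1"
    using SL2C.int_pow_closed[of "twist_matrix A B" n] det_twist_matrix[OF AB(1,2)] by simp
  then have "trace A = trace B"
    using AB(3) by (rule intertwined_trace_eq)
  \<comment> \<open>The alternative \<open>A = B\<close> makes the two traces equal, so it is
    absorbed by the factor \<open>x - z\<close>.\<close>
  from twist_relation_matrix[where r = r, OF AB(1,2) this xz rec init] AB(3)
  show "(x - z) * r n = 0" using xz by auto
next
  assume zero: "(x - z) * r n = 0"
  obtain A B :: "complex^2^2" where AB: "det A = 1" "det B = 1" "trace A = trace B"
    "trace (A ** A) = x" "trace (A ** B) = z" "x = z \<longrightarrow> A = B"
    by (rule SL2C_pair_exists[of x z])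
  have "A ** (twist_matrix A B [^]\<^bsub>SL2C\<^esub> n) = (twist_matrix A B [^]\<^bsub>SL2C\<^esub> n) ** B"
    using zero AB(6)
    by (subst twist_relation_matrix[where r = r, OF AB(1-3) AB(4,5)[symmetric] rec init]) auto
  from twist_hom_exists[OF AB(1,2) this] obtain \<rho> where \<rho>: "\<rho> \<in> hom (twist_group n) SL2C"
    "\<And>u. \<rho> (word_class (twist_relations n) u) = word_val SL2C (gen_images A B) u"
    by blast
  show "(x, z) \<in> character_variety n"
    unfolding character_variety_def using character_point_eq[OF \<rho>(2)] \<rho>(1) AB(4,5)
    by (metis imageI)
qed

text \<open>
  Writing \<open>B = A + N\<close>, the hypothesis on the traces says \<open>N\<^sup>2 = 0\<close> and \<open>N A N = 0\<close>, and the two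
  matrices are \<open>1 + P\<close> and \<open>1 + Q\<close> with \<open>P = (A\<^sup>-\<^sup>1 - A) N\<close>, \<open>Q = A P A\<^sup>-\<^sup>1\<close> and \<open>P Q = Q P = 0\<close>.
\<close>

lemma reducible_twist_matrix_commutes:
  assumes det: "det A = 1" "det B = 1" and trace: "trace A = trace B"
    and reducible: "trace (A ** A) = trace (A ** B)"
  shows "twist_matrix A B ** (A ** twist_matrix A B ** adj2 A) =
    (A ** twist_matrix A B ** adj2 A) ** twist_matrix A B"
proof -
  define N where "N = B - A"
  define P Q where "P = (adj2 A - A) ** N" and "Q = A ** P ** adj2 A"
  define a b c d p q r s where ent: "a = A$1$1" "b = A$1$2" "c = A$2$1" "d = A$2$2"
    "p = B$1$1" "q = B$1$2" "r = B$2$1" "s = B$2$2"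
  have eqs: "a * d - b * c = 1" "p * s - q * r = 1" "a + d = p + s"
    "a * a + b * c + (c * b + d * d) = a * p + b * r + (c * q + d * s)"
    using det trace reducible by (auto simp: ent det_2 trace_2 mat2_mult)
  have W: "twist_matrix A B = mat 1 + P"
    unfolding twist_matrix_def P_def N_def mat2_eq_iff vector_minus_component
      vector_add_component mat2_mult adj2_entries mat2_one_entries ent[symmetric]
    using eqs by (intro conjI; algebra)
  \<comment> \<open>By Cayley-Hamilton, \<open>A ** (adj2 A - A)\<close> and
    \<open>adj2 A ** (adj2 A - A)\<close> are linear combinations of the identity and
    \<open>A\<close>, so both sandwiches reduce to \<open>N ** N\<close> and
    \<open>N ** A ** N\<close>.\<close>
  have 1: "N ** (A ** (adj2 A - A)) ** N = 0"
    unfolding N_def mat2_eq_iff vector_minus_component mat2_mult adj2_entries zero_index ent[symmetric]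
    using eqs by (intro conjI; algebra)
  have 2: "N ** (adj2 A ** (adj2 A - A)) ** N = 0"
    unfolding N_def mat2_eq_iff vector_minus_component mat2_mult adj2_entries zero_index ent[symmetric]
    using eqs by (intro conjI; algebra)
  have "P ** Q = (adj2 A - A) ** (N ** (A ** (adj2 A - A)) ** N) ** adj2 A"
    by (simp add: P_def Q_def matrix_mul_assoc)
  moreover have "Q ** P = A ** (adj2 A - A) ** (N ** (adj2 A ** (adj2 A - A)) ** N)"
    by (simp add: P_def Q_def matrix_mul_assoc)
  ultimately have PQ: "P ** Q = 0" "Q ** P = 0"
    unfolding 1 2 by (simp_all add: mat2_eq_iff mat2_mult)
  have "A ** adj2 A = mat 1"
    using det(1) SL2C.r_inv[of A] by (simp add: inv_SL2C)
  then have H: "A ** twist_matrix A B ** adj2 A = mat 1 + Q"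
    by (simp add: W Q_def matrix_add_ldistrib mat2_add_rdistrib)
  show ?thesis
    unfolding H unfolding W by (simp add: matrix_add_ldistrib mat2_add_rdistrib PQ add_ac)
qed

text \<open>Here \<open>A ** B\<close> has trace \<open>2 + s\<close>, so these pairs realize all
  points \<open>(2, c)\<close> with \<open>c\<close> other than 2. The upper left entries of the two
  products differ by \<open>2 * s^3\<close>.\<close>

lemma parabolic_twist_matrix_not_commutes:
  fixes s :: complex
  defines "A \<equiv> vector [vector [1, 1], vector [0, 1]]"
    and "B \<equiv> vector [vector [1, 0], vector [s, 1]]"
  assumes "s \<noteq> 0"
  shows "twist_matrix A B ** (A ** twist_matrix A B ** adj2 A) \<noteq>
    (A ** twist_matrix A B ** adj2 A) ** twist_matrix A B"
proof
  assume eq: "twist_matrix A B ** (A ** twist_matrix A B ** adj2 A) =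
    (A ** twist_matrix A B ** adj2 A) ** twist_matrix A B"
  have W: "twist_matrix A B = vector [vector [1 - s + s\<^sup>2, - s], vector [- s\<^sup>2, 1 + s]]"
    by (simp add: twist_matrix_def A_def B_def mat2_eq_iff mat2_mult algebra_simps power2_eq_square)
  have H: "A ** twist_matrix A B ** adj2 A =
      vector [vector [1 - s, s], vector [- s\<^sup>2, 1 + s + s\<^sup>2]]"
    unfolding W by (simp add: A_def mat2_eq_iff mat2_mult algebra_simps power2_eq_square)
  from eq have "s ^ 3 = 0"
    unfolding H unfolding W
    by (simp add: mat2_eq_iff mat2_mult algebra_simps power2_eq_square power3_eq_cube)
  with \<open>s \<noteq> 0\<close> show False by simp
qed

text \<open>The recurrence is the given one on the parabolic line \<open>x = 2\<close>, where
  \<open>t(2, c) = 2 + (c - 2)^2\<close>. The root \<open>c\<close> supplies a second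
  representation, which refutes the commutation that reducibility would force.\<close>

lemma faithful_character_not_reducible:
  fixes r :: "int \<Rightarrow> complex"
  assumes faithful: "discrete_faithful n \<rho>"
    and rec: "\<And>n. r (n + 1) - (2 + (c - 2)\<^sup>2) * r n + r (n - 1) = 0"
    and init: "r 0 = 1" "r 1 = c - 1"
    and root: "r n = 0" "c \<noteq> 2"
  shows "fst (character_point n \<rho>) \<noteq> snd (character_point n \<rho>)"
proof
  assume red: "fst (character_point n \<rho>) = snd (character_point n \<rho>)"
  have \<rho>: "\<rho> \<in> hom (twist_group n) SL2C"
    using faithful by (simp add: discrete_faithful_def)
  let ?u = "twist_word" and ?v = "[(Gen_a, True)] @ twist_word @ [(Gen_a, False)]"
  let ?W = "word_class (twist_relations n)"
  have val: "word_val SL2C (gen_images A B) (?u @ ?v) =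
      twist_matrix A B ** (A ** twist_matrix A B ** adj2 A)"
    "word_val SL2C (gen_images A B) (?v @ ?u) =
      A ** twist_matrix A B ** adj2 A ** twist_matrix A B"
    if "det A = 1" "det B = 1" for A B
    using that
    by (simp_all add: word_val_twist_word SL2C.word_val_append det_gen_images inv_SL2C matrix_mul_assoc)
  obtain A B where AB: "det A = 1" "det B = 1"
    "A ** (twist_matrix A B [^]\<^bsub>SL2C\<^esub> n) = (twist_matrix A B [^]\<^bsub>SL2C\<^esub> n) ** B"
    "\<And>u. \<rho> (?W u) = word_val SL2C (gen_images A B) u"
    using twist_homE[OF \<rho>] by blast
  have "det (twist_matrix A B [^]\<^bsub>SL2C\<^esub> n) = 1"
    using SL2C.int_pow_closed[of "twist_matrix A B" n] det_twist_matrix[OF AB(1,2)] by simp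
  then have "trace A = trace B"
    using AB(3) by (rule intertwined_trace_eq)
  moreover have "trace (A ** A) = trace (A ** B)"
    using red character_point_eq[OF AB(4)] by simp
  ultimately have "\<rho> (?W (?u @ ?v)) = \<rho> (?W (?v @ ?u))"
    unfolding AB(4) val[OF AB(1,2)] by (intro reducible_twist_matrix_commutes AB)
  \<comment> \<open>Faithfulness lifts the equality of matrices to the group itself, so the two
    words agree in every representation.\<close>
  then have eq: "?W (?u @ ?v) = ?W (?v @ ?u)"
    using faithful unfolding discrete_faithful_def twist_group_def presented_group_def by auto
  define A' B' :: "complex^2^2" where "A' = vector [vector [1, 1], vector [0, 1]]"
    and "B' = vector [vector [1, 0], vector [c - 2, 1]]"
  have AB': "det A' = 1" "det B' = 1" "trace A' = trace B'" "2 = trace (A' ** A')" "c = trace (A' ** B')"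
    by (simp_all add: A'_def B'_def det_2 trace_2 mat2_mult)
  have "r (n + 1) - (2 + 2 * 2 - 2 * c - 2 * c + c\<^sup>2) * r n + r (n - 1) = 0" for n
    using rec[of n] by algebra
  from twist_relation_matrix[where r = r, OF AB' this init, of n] root
  have "A' ** (twist_matrix A' B' [^]\<^bsub>SL2C\<^esub> n) = (twist_matrix A' B' [^]\<^bsub>SL2C\<^esub> n) ** B'"
    by simp
  then obtain \<sigma> where "\<And>u. \<sigma> (?W u) = word_val SL2C (gen_images A' B') u"
    using twist_hom_exists[OF AB'(1,2)] by blast
  from this[of "?u @ ?v"] this[of "?v @ ?u"]
  have "twist_matrix A' B' ** (A' ** twist_matrix A' B' ** adj2 A') =
      (A' ** twist_matrix A' B' ** adj2 A') ** twist_matrix A' B'"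
    unfolding eq val[OF AB'(1,2)] by simp
  with parabolic_twist_matrix_not_commutes[of "c - 2"] root(2) show False
    by (simp add: A'_def B'_def)
qed


section \<open>Plane curves\<close>


lemma eval_xz_simps [simp]:
  "eval_xz 0 v = 0" "eval_xz 1 v = 1" "eval_xz (p + q) v = eval_xz p v + eval_xz q v"
  "eval_xz (p - q) v = eval_xz p v - eval_xz q v" "eval_xz (p * q) v = eval_xz p v * eval_xz q v"
  "eval_xz [:c:] v = poly c (fst v)"
  by (auto simp: eval_xz_def split: prod.split)

lemma eval_xz_vars [simp]: "eval_xz varX v = fst v" "eval_xz varZ v = snd v"
  by (auto simp: eval_xz_def varX_def varZ_def split: prod.split)

text \<open>\<open>eval_xz\<close> substitutes \<open>z\<close> first. Substituting \<open>x\<close>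
  first instead leaves a polynomial in \<open>z\<close> alone, to which the fundamental theorem of
  algebra applies.\<close>

lemma eval_xz_conv_poly:
  "eval_xz p (x, z) = poly (map_poly (\<lambda>c. poly c x) p) z"
  by (induction p) (simp_all add: eval_xz_def map_poly_pCons)

lemma
  shows complexify_0 [simp]: "complexify 0 = 0"
    and complexify_1 [simp]: "complexify 1 = 1"
    and complexify_add [simp]: "complexify (p + q) = complexify p + complexify q"
    and complexify_diff [simp]: "complexify (p - q) = complexify p - complexify q"
    and complexify_mult [simp]: "complexify (p * q) = complexify p * complexify q"
    and complexify_varX [simp]: "complexify varX = varX"
    and complexify_varZ [simp]: "complexify varZ = varZ"
proof -
  show "complexify 0 = 0" "complexify 1 = 1" "complexify varX = varX" "complexify varZ = varZ"
    by (simp_all add: complexify_def varX_def varZ_def map_poly_pCons)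
  show "complexify (p + q) = complexify p + complexify q"
    "complexify (p - q) = complexify p - complexify q"
    by (simp_all add: complexify_def poly_eq_iff coeff_map_poly)
  show "complexify (p * q) = complexify p * complexify q"
    by (simp add: complexify_def poly_eq_iff coeff_map_poly coeff_mult coeff_sum)
qed

section \<open>A Nullstellensatz for plane curves\<close>

text \<open>A Bezout identity over the fraction field of the coefficients, with denominators
  cleared. An element \<open>h\<close> of least degree in the ideal of \<open>f\<close> and
  \<open>q\<close> divides nonzero constant multiples of both, and primality of \<open>f\<close>
  forces \<open>h\<close> to be constant.\<close>

lemma prime_elem_resultant:
  fixes f q :: "'a::idom poly"
  assumes f: "prime_elem f" "degree f > 0" and "\<not> f dvd q"
  obtains u v g where "g \<noteq> 0" "u * f + v * q = [:g:]"
proof -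
  define I where "I = {h. h \<noteq> 0 \<and> (\<exists>u v. h = u * f + v * q)}"
  have "f \<noteq> 0" using f by auto
  then have "f \<in> I"
    unfolding I_def mem_Collect_eq by (intro conjI exI[of _ 1] exI[of _ 0]) simp_all
  then obtain h where h: "h \<in> I" and min: "\<And>k. k \<in> I \<Longrightarrow> degree h \<le> degree k"
    using ex_has_least_nat[of "\<lambda>h. h \<in> I" f degree] by blast
  from h obtain u v where uv: "h \<noteq> 0" "h = u * f + v * q"
    by (auto simp: I_def)
  have div: "\<exists>c s. c \<noteq> 0 \<and> smult c k = h * s" if k: "k = f \<or> k = q" for k
  proof -
    obtain c s where cs: "c \<noteq> 0" "smult c k = h * s + pseudo_mod k h"
      using pseudo_mod(1)[OF uv(1)] by blast
    obtain u' v' where k': "k = u' * f + v' * q"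
      using k by (metis add_0 add_0_right mult_1 mult_zero_left)
    \<comment> \<open>The pseudo-remainder lies in the ideal and is zero or of smaller degree than
      \<open>h\<close>; minimality leaves only zero.\<close>
    have "pseudo_mod k h = smult c k - h * s"
      using cs(2) by simp
    also have "\<dots> = ([:c:] * u' - u * s) * f + ([:c:] * v' - v * s) * q"
      unfolding k' uv(2) by (simp add: algebra_simps smult_add_right)
    finally have "pseudo_mod k h = 0"
      using pseudo_mod(2)[OF uv(1), of k] min[of "pseudo_mod k h"] by (force simp: I_def)
    with cs show ?thesis by auto
  qed
  obtain c s where cs: "c \<noteq> 0" "smult c f = h * s" using div by blast
  obtain c' s' where cs': "c' \<noteq> 0" "smult c' q = h * s'" using div by blast
  have not_dvd_const: "\<not> f dvd [:e:]" if "e \<noteq> 0" for e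
    using that f(2) dvd_imp_degree_le[of f "[:e:]"] by auto
  have "f dvd h * s"
    using cs(2) by (metis dvd_smult dvd_refl)
  then have "f dvd h \<or> f dvd s"
    using f(1) by (simp add: prime_elem_dvd_mult_iff)
  moreover have "\<not> f dvd h"
  proof
    assume "f dvd h"
    then have "f dvd [:c':] * q"
      using cs'(2) by (simp add: dvd_mult2)
    from prime_elem_dvd_multD[OF f(1) this] not_dvd_const[OF cs'(1)] \<open>\<not> f dvd q\<close> show False
      by blast
  qed
  \<comment> \<open>Cancelling \<open>f\<close> now shows that \<open>h\<close> divides a nonzero
    constant.\<close>
  ultimately have "f dvd s" by blast
  then obtain s2 where "s = f * s2" by (rule dvdE)
  with cs(2) have "f * [:c:] = f * (h * s2)" by (simp add: ac_simps)
  with \<open>f \<noteq> 0\<close> have "h * s2 = [:c:]" by (metis mult_left_cancel)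
  then have "degree h = 0"
    using cs(1) uv(1) by (metis degree_mult_eq degree_pCons_0 add_is_0 mult_zero_right pCons_eq_0_iff)
  then obtain g where "h = [:g:]" by (rule degree_eq_zeroE)
  with uv have "g \<noteq> 0" "u * f + v * q = [:g:]" by auto
  then show ?thesis by (rule that)
qed

text \<open>If \<open>f\<close> does not involve \<open>z\<close>, its zero set is a vertical line
  and \<open>f\<close> is a linear factor up to a unit. Otherwise the Bezout identity would make
  \<open>g\<close> vanish at the abscissa of every zero of \<open>f\<close>, which can be
  avoided.\<close>

lemma prime_elem_dvd_of_zero_set:
  fixes f q :: "complex poly poly"
  assumes f: "prime_elem f" and zeros: "\<And>v. eval_xz f v = 0 \<Longrightarrow> eval_xz q v = 0"
  shows "f dvd q"
proof (cases "degree f = 0")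
  case True
  then obtain c where c: "f = [:c:]" by (rule degree_eq_zeroE)
  have "c \<noteq> 0" "\<not> is_unit c"
    using f by (auto simp: c prime_elem_def is_unit_const_poly_iff)
  then have "degree c \<noteq> 0"
    using is_unit_iff_degree by blast
  then obtain x where x: "poly c x = 0"
    by (metis constant_degree fundamental_theorem_of_algebra)
  then obtain e where e: "c = [:-x, 1:] * e"
    using poly_eq_0_iff_dvd by blast
  have f_eq: "f = [:[:-x, 1:]:] * [:e:]"
    by (simp add: c e)
  have "[:[:-x, 1:]:] dvd q"
  proof -
    have "map_poly (\<lambda>c. poly c x) q = 0"
    proof (rule poly_all_0_iff_0[THEN iffD1, rule_format])
      fix z
      show "poly (map_poly (\<lambda>c. poly c x) q) z = 0"
        using zeros[of "(x, z)"] x by (simp add: c eval_xz_conv_poly[symmetric])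
    qed
    then have "poly (coeff q i) x = 0" for i
      by (metis coeff_0 coeff_map_poly poly_0)
    then show ?thesis
      by (simp add: const_poly_dvd_iff poly_eq_0_iff_dvd)
  qed
  moreover have "is_unit [:e:]"
  proof -
    have "irreducible f"
      using f by (rule prime_elem_imp_irreducible)
    then have "is_unit [:[:-x, 1:]:] \<or> is_unit [:e:]"
      using f_eq by (rule irreducibleD)
    moreover have "\<not> is_unit [:-x, 1:]"
      by (simp add: is_unit_iff_degree)
    ultimately show ?thesis
      by (auto simp only: is_unit_const_poly_iff)
  qed
  ultimately show ?thesis
    unfolding f_eq by (simp only: mult_unit_dvd_iff)
next
  case False
  show ?thesis
  proof (rule ccontr)
    assume "\<not> f dvd q"
    moreover have "degree f > 0" using False by simp
    ultimately obtain u v g where g: "g \<noteq> 0" "u * f + v * q = [:g:]"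
      by (metis prime_elem_resultant f)
    have "f \<noteq> 0" using f by auto
    then have "g * lead_coeff f \<noteq> 0" using g(1) by simp
    \<comment> \<open>Nonvanishing of the leading coefficient keeps \<open>f\<close> nonconstant in
      \<open>z\<close> at this \<open>x\<close>, so there is a zero above it; nonvanishing of
      \<open>g\<close> then gives the contradiction.\<close>
    then obtain x where "poly (g * lead_coeff f) x \<noteq> 0"
      using poly_all_0_iff_0 by blast
    then have x: "poly g x \<noteq> 0" "poly (lead_coeff f) x \<noteq> 0" by auto
    have "degree (map_poly (\<lambda>c. poly c x) f) \<noteq> 0"
      using False le_degree[of "map_poly (\<lambda>c. poly c x) f" "degree f"] x(2)
      by (auto simp: coeff_map_poly)
    then obtain z where "eval_xz f (x, z) = 0"
      unfolding eval_xz_conv_poly by (metis constant_degree fundamental_theorem_of_algebra)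
    moreover from this have "eval_xz q (x, z) = 0" by (rule zeros)
    ultimately have "eval_xz (u * f + v * q) (x, z) = 0" by simp
    with x(1) show False by (simp add: g(2))
  qed
qed

text \<open>Each prime factor of \<open>p\<close> divides \<open>q\<close> by the prime case, and it
  occurs in \<open>p\<close> only once, so multiplicities compare.\<close>

lemma squarefree_dvd_of_zero_set:
  fixes p q :: "complex poly poly"
  assumes "squarefree p" and zeros: "\<And>v. eval_xz p v = 0 \<Longrightarrow> eval_xz q v = 0"
  shows "p dvd q"
proof (cases "q = 0")
  case False
  have "p \<noteq> 0" using assms(1) by auto
  show ?thesis
  proof (rule multiplicity_le_imp_dvd)
    fix f :: "complex poly poly" assume f: "prime f"
    show "multiplicity f p \<le> multiplicity f q"
    proof (cases "f dvd p")
      case True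
      then have "f dvd q"
        using f zeros by (intro prime_elem_dvd_of_zero_set) (auto elim!: dvdE)
      then have "multiplicity f q \<ge> 1"
        using f False by (intro multiplicity_geI) auto
      moreover have "multiplicity f p \<le> 1"
        using assms(1) f \<open>p \<noteq> 0\<close> by (simp add: squarefree_factorial_semiring'')
      ultimately show ?thesis by simp
    qed (simp add: not_dvd_imp_multiplicity_0)
  qed fact
qed simp

section \<open>Irreducible sets and components of plane curves\<close>

lemma algebraic_set_zero_set: "algebraic_set {v. eval_xz p v = 0}"
  unfolding algebraic_set_def by (rule exI[of _ "{p}"]) simp

lemma algebraic_set_Int:
  assumes "algebraic_set A" "algebraic_set B"
  shows "algebraic_set (A \<inter> B)"
proof -
  obtain P Q where "A = {v. \<forall>p\<in>P. eval_xz p v = 0}" "B = {v. \<forall>p\<in>Q. eval_xz p v = 0}"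
    using assms by (auto simp: algebraic_set_def)
  then have "A \<inter> B = {v. \<forall>p\<in>P \<union> Q. eval_xz p v = 0}" by auto
  then show ?thesis unfolding algebraic_set_def by blast
qed

text \<open>If the curve were covered by two proper parts, each would have an equation not vanishing
  on the whole curve. Their product does vanish there, so the prime \<open>f\<close> divides one of
  them.\<close>

lemma irreducible_set_prime_zero_set:
  assumes f: "prime_elem f"
  shows "irreducible_set {v. eval_xz f v = 0}"
  unfolding irreducible_set_def
proof (intro conjI allI impI algebraic_set_zero_set)
  show "{v. eval_xz f v = 0} \<noteq> {}"
    \<comment> \<open>With no zeros, \<open>f\<close> would divide 1.\<close>
    using prime_elem_dvd_of_zero_set[OF f, of 1] f by auto
next
  fix A B assume AB: "algebraic_set A \<and> algebraic_set B \<and> {v. eval_xz f v = 0} = A \<union> B"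
  then obtain P Q where PQ: "A = {v. \<forall>p\<in>P. eval_xz p v = 0}" "B = {v. \<forall>p\<in>Q. eval_xz p v = 0}"
    by (auto simp: algebraic_set_def)
  show "{v. eval_xz f v = 0} = A \<or> {v. eval_xz f v = 0} = B"
  proof (rule ccontr)
    assume "\<not> ?thesis"
    with AB have "\<not> {v. eval_xz f v = 0} \<subseteq> A" "\<not> {v. eval_xz f v = 0} \<subseteq> B" by blast+
    then obtain p q v w where pq: "p \<in> P" "q \<in> Q" and
      vw: "eval_xz f v = 0" "eval_xz p v \<noteq> 0" "eval_xz f w = 0" "eval_xz q w \<noteq> 0"
      unfolding PQ by blast
    have "eval_xz (p * q) v = 0" if "eval_xz f v = 0" for v
    proof -
      have "v \<in> A \<union> B" using that AB by blast
      then show ?thesis using pq by (auto simp: PQ)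
    qed
    then have "f dvd p * q"
      by (rule prime_elem_dvd_of_zero_set[OF f])
    then have "f dvd p \<or> f dvd q"
      using f by (simp add: prime_elem_dvd_mult_iff)
    then show False using vw by (auto elim!: dvdE)
  qed
qed

lemma irreducible_set_subset_zero_set_mult:
  assumes C: "irreducible_set C" and sub: "C \<subseteq> {v. eval_xz (p * q) v = (0 :: complex)}"
  shows "C \<subseteq> {v. eval_xz p v = 0} \<or> C \<subseteq> {v. eval_xz q v = 0}"
proof -
  have "algebraic_set (C \<inter> {v. eval_xz p v = 0})" "algebraic_set (C \<inter> {v. eval_xz q v = 0})"
    using C by (auto simp: irreducible_set_def intro: algebraic_set_Int algebraic_set_zero_set)
  moreover have "C = (C \<inter> {v. eval_xz p v = 0}) \<union> (C \<inter> {v. eval_xz q v = 0})"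
    using sub by auto
  ultimately have "C = C \<inter> {v. eval_xz p v = 0} \<or> C = C \<inter> {v. eval_xz q v = 0}"
    using C unfolding irreducible_set_def by blast
  then show ?thesis by blast
qed

text \<open>Prime factors are split off one at a time, \<open>C\<close> lying in the zero set of the
  factor or of the cofactor. The process cannot end at a unit, which has no zeros while
  \<open>C\<close> is nonempty.\<close>

lemma irreducible_set_subset_prime_zero_set:
  fixes F :: "complex poly poly"
  assumes C: "irreducible_set C" and "F \<noteq> 0" "C \<subseteq> {v. eval_xz F v = 0}"
  obtains f where "prime f" "f dvd F" "C \<subseteq> {v. eval_xz f v = 0}"
proof -
  have "\<exists>f. prime f \<and> f dvd F \<and> C \<subseteq> {v. eval_xz f v = 0}"
    using assms(2,3)
  proof (induction F rule: prime_divisors_induct)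
    case (unit F)
    then obtain G where "F * G = 1" by (metis dvdE)
    then have "eval_xz F v * eval_xz G v = 1" for v
      using eval_xz_simps(5)[of F G v] by simp
    then have "eval_xz F v \<noteq> 0" for v by (metis mult_zero_left zero_neq_one)
    with unit(3) have "C = {}" by auto
    with C show ?case by (simp add: irreducible_set_def)
  next
    case (factor p F)
    from irreducible_set_subset_zero_set_mult[OF C factor.prems(2)] show ?case
      using factor.IH factor.hyps factor.prems(1) by (auto intro: dvd_mult)
  qed auto
  then show ?thesis using that by blast
qed

text \<open>The curve of the prime factor containing \<open>C\<close> is itself irreducible, so
  maximality of \<open>C\<close> gives equality.\<close>

lemma irreducible_component_zero_set:
  fixes F :: "complex poly poly"
  assumes "irreducible_component C {v. eval_xz F v = 0}" "F \<noteq> 0"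
  obtains f where "prime f" "f dvd F" "C = {v. eval_xz f v = 0}"
proof -
  have C: "irreducible_set C" "C \<subseteq> {v. eval_xz F v = 0}"
    and max: "\<And>D. irreducible_set D \<Longrightarrow> C \<subseteq> D \<Longrightarrow> D \<subseteq> {v. eval_xz F v = 0} \<Longrightarrow> D = C"
    using assms(1) by (auto simp: irreducible_component_def)
  obtain f where f: "prime f" "f dvd F" "C \<subseteq> {v. eval_xz f v = 0}"
    using irreducible_set_subset_prime_zero_set[OF C(1) assms(2) C(2)] .
  have "{v. eval_xz f v = 0} = C"
    using f by (intro max irreducible_set_prime_zero_set) (auto elim!: dvdE)
  with f that show ?thesis by blast
qed


section \<open>The character variety\<close>

text \<open>Two different values show that \<open>p n\<close> is not constant, so it has a root.
  Since its value at 2 is 1, that root is not 2.\<close>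

lemma parabolic_root_exists:
  fixes p :: "int \<Rightarrow> complex poly"
  assumes rec: "\<And>n c. poly (p (n + 1)) c - (2 + (c - 2)\<^sup>2) * poly (p n) c + poly (p (n - 1)) c = 0"
    and init: "\<And>c. poly (p 0) c = 1" "\<And>c. poly (p 1) c = c - 1"
    and "n \<noteq> 0"
  obtains c where "c \<noteq> 2" "poly (p n) c = 0"
proof -
  have at_2: "poly (p n) 2 = 1"
    by (rule recurrence_unique[where t = 2 and X = "\<lambda>n. poly (p n) 2"])
      (use rec[of _ 2] in \<open>simp_all add: init\<close>)
  txt \<open>At \<open>c = 2 + 2 \<i>\<close> the characteristic polynomial has the double root \<open>-1\<close>.\<close>
  define s :: "int \<Rightarrow> complex" where "s n = (if even n then 1 else - 1)" for n
  have s: "s (n + 1) = - s n" "s (n - 1) = - s n" for n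
    by (auto simp: s_def)
  have "poly (p n) (2 + 2 * \<i>) = s n * (1 - of_int n * (2 + 2 * \<i>))"
  proof (rule recurrence_unique[where t = "- 2" and X = "\<lambda>n. poly (p n) (2 + 2 * \<i>)"])
    fix n
    show "poly (p (n + 1)) (2 + 2 * \<i>) - - 2 * poly (p n) (2 + 2 * \<i>)
        + poly (p (n - 1)) (2 + 2 * \<i>) = 0"
      using rec[of n "2 + 2 * \<i>"] by (simp add: power_mult_distrib)
    show "s (n + 1) * (1 - of_int (n + 1) * (2 + 2 * \<i>)) - - 2 * (s n * (1 - of_int n * (2 + 2 * \<i>)))
        + s (n - 1) * (1 - of_int (n - 1) * (2 + 2 * \<i>)) = 0"
      unfolding s by (simp add: algebra_simps)
  qed (simp_all add: init s_def)
  \<comment> \<open>The imaginary part is \<open>2 n\<close> up to sign.\<close>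
  also have "\<dots> \<noteq> 1"
    using \<open>n \<noteq> 0\<close> by (auto simp: s_def complex_eq_iff)
  finally have "\<not> constant (poly (p n))"
    using at_2 unfolding constant_def by metis
  then obtain c where "poly (p n) c = 0"
    using fundamental_theorem_of_algebra by blast
  with at_2 that[of c] show ?thesis by force
qed

theorem lemma1:
  fixes r :: "int \<Rightarrow> int poly poly" and t :: "int poly poly"
  assumes "t = 2 + 2 * varX - 2 * varZ - varX * varZ + varZ ^ 2"
    and "\<And>n. r (n + 1) - t * r n + r (n - 1) = 0"
    and "r 0 = 1" and "r 1 = varZ - 1"
  shows "(\<forall>n. defining_polynomial (complexify ((varX - varZ) * r n)) (character_variety n)) \<and>
    (\<forall>n \<rho> X\<^sub>0. n \<noteq> 0 \<and> n \<noteq> 1 \<and> discrete_faithful n \<rho> \<and>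
        irreducible_component X\<^sub>0 (character_variety n) \<and> character_point n \<rho> \<in> X\<^sub>0 \<longrightarrow>
      (\<exists>p. squarefree p \<and> defining_polynomial p X\<^sub>0) \<and>
      (\<forall>p. squarefree p \<and> defining_polynomial p X\<^sub>0 \<longrightarrow> p dvd complexify (r n)))"
proof -
  have two: "complexify 2 = 2" "eval_xz (2 :: complex poly poly) v = 2" for v
    by (metis complexify_add complexify_1 one_add_one) (metis eval_xz_simps(2,3) one_add_one)
  define R where "R n v = eval_xz (complexify (r n)) v" for n v
  have rec: "R (n + 1) (x, z) - (2 + 2 * x - 2 * z - x * z + z\<^sup>2) * R n (x, z) + R (n - 1) (x, z) = 0"
    for n x z
    using arg_cong[OF assms(2)[of n], of "\<lambda>p. eval_xz (complexify p) (x, z)"]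
    by (simp add: R_def assms(1) two power2_eq_square)
  have init: "R 0 (x, z) = 1" "R 1 (x, z) = z - 1" for x z
    by (simp_all add: R_def assms(3,4))
  have F: "complexify ((varX - varZ) * r n) = (varX - varZ) * complexify (r n)" for n
    by simp
  have V: "{v. eval_xz (complexify ((varX - varZ) * r n)) v = 0} = character_variety n" for n
  proof (rule Set.set_eqI)
    fix v :: "complex \<times> complex"
    obtain x z where "v = (x, z)" by (cases v)
    with character_variety_iff[where r = "\<lambda>n. R n (x, z)", OF rec init]
    show "v \<in> {v. eval_xz (complexify ((varX - varZ) * r n)) v = 0} \<longleftrightarrow> v \<in> character_variety n"
      by (simp add: R_def)
  qed
  have X0: "(\<exists>p. squarefree p \<and> defining_polynomial p X\<^sub>0) \<and>
      (\<forall>p. squarefree p \<and> defining_polynomial p X\<^sub>0 \<longrightarrow> p dvd complexify (r n))"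
    if "n \<noteq> 0" and \<rho>: "discrete_faithful n \<rho>" "character_point n \<rho> \<in> X\<^sub>0"
      and comp: "irreducible_component X\<^sub>0 (character_variety n)" for n \<rho> X\<^sub>0
  proof -
    \<comment> \<open>The restriction of the polynomials to the parabolic line
      \<open>x = 2\<close>.\<close>
    define p where "p n = map_poly (\<lambda>c. poly c 2) (complexify (r n))" for n
    have p: "poly (p n) c = R n (2, c)" for n c
      by (simp add: p_def R_def eval_xz_conv_poly)
    have rec2: "R (n + 1) (2, c) - (2 + (c - 2)\<^sup>2) * R n (2, c) + R (n - 1) (2, c) = 0" for n c
      using rec[of n 2 c] by (simp add: power2_eq_square algebra_simps)
    obtain c where c: "c \<noteq> 2" "R n (2, c) = 0"
      using parabolic_root_exists[of p n] rec2 init \<open>n \<noteq> 0\<close> by (auto simp: p)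
    have off_line: "fst (character_point n \<rho>) \<noteq> snd (character_point n \<rho>)"
      by (rule faithful_character_not_reducible[where r = "\<lambda>n. R n (2, c)", OF \<rho>(1) rec2 init c(2,1)])
    \<comment> \<open>The value at this point shows that \<open>r n\<close> is not the zero
      polynomial, so the curve is proper and its components come from prime factors.\<close>
    have "R n (2, 2) = 1"
      by (rule recurrence_unique[where t = 2 and X = "\<lambda>n. R n (2, 2)"])
        (use rec2[of _ 2] in \<open>simp_all add: init\<close>)
    then have "complexify (r n) \<noteq> 0" by (auto simp: R_def)
    moreover have "varX - varZ \<noteq> (0 :: complex poly poly)"
      by (simp add: varX_def varZ_def)
    ultimately have nz: "complexify ((varX - varZ) * r n) \<noteq> 0"
      unfolding F by simp
    obtain f where "prime f" "X\<^sub>0 = {v. eval_xz f v = 0}"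
      using irreducible_component_zero_set[OF comp[folded V] nz] .
    then have "squarefree f \<and> defining_polynomial f X\<^sub>0"
      by (auto simp: defining_polynomial_def squarefree_prime)
    moreover have "p dvd complexify (r n)" if "squarefree p" "defining_polynomial p X\<^sub>0" for p
    proof -
      \<comment> \<open>An irreducible set lies in one of the two curves; the character off the line
        excludes the first.\<close>
      have "X\<^sub>0 \<subseteq> {v. eval_xz (varX - varZ) v = 0} \<or> X\<^sub>0 \<subseteq> {v. eval_xz (complexify (r n)) v = 0}"
        using comp[folded V] unfolding F irreducible_component_def
        by (intro irreducible_set_subset_zero_set_mult) auto
      then have "X\<^sub>0 \<subseteq> {v. eval_xz (complexify (r n)) v = 0}"
        using \<rho>(2) off_line by auto
      then show ?thesis
        using that by (intro squarefree_dvd_of_zero_set) (auto simp: defining_polynomial_def)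
    qed
    ultimately show ?thesis by blast
  qed
  show ?thesis
  proof (intro conjI[of "\<forall>n. P n" for P] allI impI)
    show "defining_polynomial (complexify ((varX - varZ) * r n)) (character_variety n)" for n
      unfolding defining_polynomial_def by (rule V)
  qed (elim conjE, rule X0)
qed

end
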